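(* Let $n$ be a positive integer. The group $G_{n,p}^{2}$ is isomorphic to the subgroup $H_{n,d}^{2}$ of $G_{n,d}^{2}$.
   Context: Convention: generators are indexed by unordered pairs, so $a_{ji}$ means $a_{ij}$ and $a_{ji}^{\epsilon}$ means $a_{ij}^{\epsilon}$; the superscript $\epsilon\in\{0,1\}$ in $a_{ij}^{\epsilon}$ is a label, not a power. $G_{n,p}^{2}$ ($G_n^2$ with parity) is the group with generators $a_{ij}^{\epsilon}$ for $\{i,j\}\subset\{1,\dots,n\}$, $i<j$, $\epsilon\in\{0,1\}$, and relations: (1) $(a_{ij}^{\epsilon})^{2}=1$ for all $i\ne j$ and $\epsilon\in\{0,1\}$; (2) $a_{ij}^{\epsilon_{ij}}a_{kl}^{\epsilon_{kl}}=a_{kl}^{\epsilon_{kl}}a_{ij}^{\epsilon_{ij}}$ for distinct $i,j,k,l$ and all $\epsilon_{ij},\epsilon_{kl}\in\{0,1\}$; (3) $a_{ij}^{\epsilon_{ij}}a_{ik}^{\epsilon_{ik}}a_{jk}^{\epsilon_{jk}}=a_{jk}^{\epsilon_{jk}}a_{ik}^{\epsilon_{ik}}a_{ij}^{\epsilon_{ij}}$ for distinct $i,j,k$ and all $\epsilon_{ij},\epsilon_{ik},\epsilon_{jk}\in\{0,1\}$ with $\epsilon_{ij}+\epsilon_{ik}+\epsilon_{jk}\equiv 0 \pmod 2$. $G_{n,d}^{2}$ ($G_n^2$ with points) is the group with generators $a_{ij}$ for $\{i,j\}\subset\{1,\dots,n\}$, $i<j$, and $\tau_{i}$ for $i\in\{1,\dots,n\}$,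 and relations: (1) $a_{ij}^{2}=1$ for $i\neq j$; (2) $a_{ij}a_{kl}=a_{kl}a_{ij}$ for distinct $i,j,k,l$; (3) $a_{ij}a_{ik}a_{jk}=a_{jk}a_{ik}a_{ij}$ for distinct $i,j,k$; (4) $\tau_{i}^{2}=1$ for all $i$; (5) $\tau_{i}\tau_{j}=\tau_{j}\tau_{i}$ for all $i,j$; (6) $\tau_{i}\tau_{j}a_{ij}\tau_{j}\tau_{i}=a_{ij}$ for distinct $i,j$; (7) $a_{ij}\tau_{k}=\tau_{k}a_{ij}$ for distinct $i,j,k$. $H_{n,d}^{2}=\{\beta\in G_{n,d}^{2} \mid N_{i}(\beta)\equiv 0 \pmod 2 \text{ for all } i\in\{1,\dots,n\}\}$, where $N_{i}(\beta)$ is the number of occurrences of $\tau_{i}$ in a word representing $\beta$. Every relation of $G_{n,d}^2$ preserves this number modulo $2$, so $N_i \bmod 2$ is well defined on $G_{n,d}^2$ and $H_{n,d}^2$ is a subgroup. *)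

theory Defs
  imports "HOL-Algebra.Coset"
begin

section \<open>Groups given by generators and relations\<close>

text \<open>
  A letter \<open>(x, b)\<close> stands for the generator \<open>x\<close> if \<open>b\<close> is \<open>False\<close>, and for its formal inverse
  if \<open>b\<close> is \<open>True\<close>.
\<close>

type_synonym 'g word = "('g \<times> bool) list"

definition words :: "'g set \<Rightarrow> 'g word set" where
  "words S = lists (S \<times> UNIV)"

text \<open>
  The least congruence on the words over \<open>S\<close> that makes \<open>x x\<inverse>\<close> and \<open>x\<inverse> x\<close> trivial and identifies
  the two sides of every relation in \<open>R\<close>.
\<close>

inductive_set word_cong :: "'g set \<Rightarrow> ('g word \<times> 'g word) set \<Rightarrow> ('g word \<times> 'g word) set"
  for S :: "'g set" and R :: "('g word \<times> 'g word) set" where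
  refl: "w \<in> words S \<Longrightarrow> (w, w) \<in> word_cong S R"
| sym: "(u, v) \<in> word_cong S R \<Longrightarrow> (v, u) \<in> word_cong S R"
| trans: "(u, v) \<in> word_cong S R \<Longrightarrow> (v, w) \<in> word_cong S R \<Longrightarrow> (u, w) \<in> word_cong S R"
| append: "(u, u') \<in> word_cong S R \<Longrightarrow> (v, v') \<in> word_cong S R \<Longrightarrow>
    (u @ v, u' @ v') \<in> word_cong S R"
| cancel: "x \<in> S \<Longrightarrow> ([(x, b), (x, \<not> b)], []) \<in> word_cong S R"
| relation: "(u, v) \<in> R \<Longrightarrow> u \<in> words S \<Longrightarrow> v \<in> words S \<Longrightarrow> (u, v) \<in> word_cong S R"

definition word_class :: "'g set \<Rightarrow> ('g word \<times> 'g word) set \<Rightarrow> 'g word \<Rightarrow> 'g word set" where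
  "word_class S R w = word_cong S R `` {w}"

definition presented_group :: "'g set \<Rightarrow> ('g word \<times> 'g word) set \<Rightarrow> 'g word set monoid" where
  "presented_group S R =
    \<lparr>carrier = words S // word_cong S R,
     mult = (\<lambda>X Y. \<Union>u\<in>X. \<Union>v\<in>Y. word_class S R (u @ v)),
     one = word_class S R []\<rparr>"

lemma words_Nil [simp]: "[] \<in> words S"
  and words_append [simp]: "u @ v \<in> words S \<longleftrightarrow> u \<in> words S \<and> v \<in> words S"
  and words_Cons [simp]: "(x, b) # w \<in> words S \<longleftrightarrow> x \<in> S \<and> w \<in> words S"
  by (auto simp: words_def)

lemma word_cong_words: "(u, v) \<in> word_cong S R \<Longrightarrow> u \<in> words S \<and> v \<in> words S"
  by (induction rule: word_cong.induct) auto

lemma equiv_word_cong: "equiv (words S) (word_cong S R)"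
  by (intro equivI refl_onI symI transI) (auto intro: word_cong.intros dest: word_cong_words)

lemma word_class_eq_iff:
  "u \<in> words S \<Longrightarrow> v \<in> words S \<Longrightarrow>
    word_class S R u = word_class S R v \<longleftrightarrow> (u, v) \<in> word_cong S R"
  unfolding word_class_def by (rule eq_equiv_class_iff[OF equiv_word_cong])

lemma word_class_in_carrier: "w \<in> words S \<Longrightarrow> word_class S R w \<in> carrier (presented_group S R)"
  by (simp add: presented_group_def word_class_def quotientI)

lemma carrier_presented_groupE:
  assumes "X \<in> carrier (presented_group S R)"
  obtains w where "w \<in> words S" "X = word_class S R w"
  using assms by (auto simp: presented_group_def word_class_def elim!: quotientE)

lemma one_presented_group: "\<one>\<^bsub>presented_group S R\<^esub> = word_class S R []"
  by (simp add: presented_group_def)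

lemma mult_presented_group:
  assumes "u \<in> words S" "v \<in> words S"
  shows "word_class S R u \<otimes>\<^bsub>presented_group S R\<^esub> word_class S R v = word_class S R (u @ v)"
proof -
  have eq: "word_class S R (u' @ v') = word_class S R (u @ v)"
    if "u' \<in> word_class S R u" "v' \<in> word_class S R v" for u' v'
  proof -
    from that have c: "(u, u') \<in> word_cong S R" "(v, v') \<in> word_cong S R"
      by (auto simp: word_class_def)
    then have "(u' @ v', u @ v) \<in> word_cong S R"
      by (blast intro: word_cong.append word_cong.sym)
    with c show ?thesis
      by (subst word_class_eq_iff) (auto dest: word_cong_words)
  qed
  moreover have "u \<in> word_class S R u" "v \<in> word_class S R v"
    using assms by (auto simp: word_class_def intro: word_cong.refl)
  ultimately have "(\<Union>u'\<in>word_class S R u. \<Union>v'\<in>word_class S R v. word_class S R (u' @ v'))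
      = word_class S R (u @ v)"
    by blast
  then show ?thesis
    by (simp add: presented_group_def)
qed

definition inv_word :: "'g word \<Rightarrow> 'g word" where
  "inv_word w = rev (map (\<lambda>(x, b). (x, \<not> b)) w)"

lemma inv_word_words: "w \<in> words S \<Longrightarrow> inv_word w \<in> words S"
  by (auto simp: inv_word_def words_def)

lemma inv_word_cancel: "w \<in> words S \<Longrightarrow> (inv_word w @ w, []) \<in> word_cong S R"
proof (induction w)
  case Nil
  then show ?case by (simp add: inv_word_def word_cong.refl)
next
  case (Cons l w)
  obtain x b where l: "l = (x, b)" by fastforce
  with Cons.prems have x: "x \<in> S" and w: "w \<in> words S" by auto
  have "([(x, \<not> b), (x, \<not> \<not> b)] @ w, [] @ w) \<in> word_cong S R"
    using x w by (intro word_cong.append word_cong.cancel word_cong.refl)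
  then have "(inv_word w @ [(x, \<not> b), (x, b)] @ w, inv_word w @ w) \<in> word_cong S R"
    using inv_word_words[OF w] by (intro word_cong.append word_cong.refl) auto
  then have "(inv_word w @ [(x, \<not> b), (x, b)] @ w, []) \<in> word_cong S R"
    using Cons.IH[OF w] by (rule word_cong.trans)
  then show ?case by (simp add: l inv_word_def)
qed

theorem group_presented_group: "group (presented_group S R)"
proof (rule groupI)
  fix X Y assume "X \<in> carrier (presented_group S R)" "Y \<in> carrier (presented_group S R)"
  then show "X \<otimes>\<^bsub>presented_group S R\<^esub> Y \<in> carrier (presented_group S R)"
    by (elim carrier_presented_groupE) (simp add: mult_presented_group word_class_in_carrier)
next
  show "\<one>\<^bsub>presented_group S R\<^esub> \<in> carrier (presented_group S R)"
    by (simp add: one_presented_group word_class_in_carrier)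
next
  fix X Y Z
  assume "X \<in> carrier (presented_group S R)" "Y \<in> carrier (presented_group S R)"
    "Z \<in> carrier (presented_group S R)"
  then show "X \<otimes>\<^bsub>presented_group S R\<^esub> Y \<otimes>\<^bsub>presented_group S R\<^esub> Z =
      X \<otimes>\<^bsub>presented_group S R\<^esub> (Y \<otimes>\<^bsub>presented_group S R\<^esub> Z)"
    by (elim carrier_presented_groupE) (simp add: mult_presented_group)
next
  fix X assume "X \<in> carrier (presented_group S R)"
  then show "\<one>\<^bsub>presented_group S R\<^esub> \<otimes>\<^bsub>presented_group S R\<^esub> X = X"
    by (elim carrier_presented_groupE) (simp add: one_presented_group mult_presented_group)
next
  fix X assume "X \<in> carrier (presented_group S R)"
  then obtain w where w: "w \<in> words S" "X = word_class S R w"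
    by (rule carrier_presented_groupE)
  have "word_class S R (inv_word w) \<otimes>\<^bsub>presented_group S R\<^esub> X = \<one>\<^bsub>presented_group S R\<^esub>"
    using w by (simp add: mult_presented_group one_presented_group inv_word_words
        word_class_eq_iff inv_word_cancel)
  then show "\<exists>Y\<in>carrier (presented_group S R).
      Y \<otimes>\<^bsub>presented_group S R\<^esub> X = \<one>\<^bsub>presented_group S R\<^esub>"
    using w inv_word_words word_class_in_carrier by blast
qed


section \<open>The group with parity\<close>

text \<open>
  The generators are indexed by unordered pairs: \<open>PA {i, j} \<epsilon>\<close> is \<open>a\<close> with lower indices \<open>i, j\<close>
  and parity label \<open>\<epsilon>\<close>, so that exchanging \<open>i\<close> and \<open>j\<close> gives the same generator.
\<close>

datatype pgen = PA "nat set" nat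

abbreviation pa :: "nat \<Rightarrow> nat \<Rightarrow> nat \<Rightarrow> pgen word" where
  "pa i j \<epsilon> \<equiv> [(PA {i, j} \<epsilon>, False)]"

definition Gp_gens :: "nat \<Rightarrow> pgen set" where
  "Gp_gens n = {PA {i, j} \<epsilon> | i j \<epsilon>. i \<in> {1..n} \<and> j \<in> {1..n} \<and> i < j \<and> \<epsilon> \<in> {0, 1}}"

definition Gp_rels :: "nat \<Rightarrow> (pgen word \<times> pgen word) set" where
  "Gp_rels n =
    {(pa i j \<epsilon> @ pa i j \<epsilon>, []) | i j \<epsilon>.
       {i, j} \<subseteq> {1..n} \<and> i \<noteq> j \<and> \<epsilon> \<in> {0, 1}}
  \<union> {(pa i j \<epsilon> @ pa k l \<epsilon>', pa k l \<epsilon>' @ pa i j \<epsilon>) | i j k l \<epsilon> \<epsilon>'.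
       {i, j, k, l} \<subseteq> {1..n} \<and> distinct [i, j, k, l] \<and> {\<epsilon>, \<epsilon>'} \<subseteq> {0, 1}}
  \<union> {(pa i j \<epsilon> @ pa i k \<epsilon>' @ pa j k \<epsilon>'', pa j k \<epsilon>'' @ pa i k \<epsilon>' @ pa i j \<epsilon>) | i j k \<epsilon> \<epsilon>' \<epsilon>''.
       {i, j, k} \<subseteq> {1..n} \<and> distinct [i, j, k] \<and> {\<epsilon>, \<epsilon>', \<epsilon>''} \<subseteq> {0, 1} \<and> even (\<epsilon> + \<epsilon>' + \<epsilon>'')}"

definition G2p :: "nat \<Rightarrow> pgen word set monoid" where
  "G2p n = presented_group (Gp_gens n) (Gp_rels n)"


section \<open>The group with points\<close>

datatype dgen = DA "nat set" | Tau nat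

abbreviation da :: "nat \<Rightarrow> nat \<Rightarrow> dgen word" where
  "da i j \<equiv> [(DA {i, j}, False)]"

abbreviation tau :: "nat \<Rightarrow> dgen word" where
  "tau i \<equiv> [(Tau i, False)]"

definition Gd_gens :: "nat \<Rightarrow> dgen set" where
  "Gd_gens n = {DA {i, j} | i j. i \<in> {1..n} \<and> j \<in> {1..n} \<and> i < j} \<union> Tau ` {1..n}"

definition Gd_rels :: "nat \<Rightarrow> (dgen word \<times> dgen word) set" where
  "Gd_rels n =
    {(da i j @ da i j, []) | i j. {i, j} \<subseteq> {1..n} \<and> i \<noteq> j}
  \<union> {(da i j @ da k l, da k l @ da i j) | i j k l.
       {i, j, k, l} \<subseteq> {1..n} \<and> distinct [i, j, k, l]}
  \<union> {(da i j @ da i k @ da j k, da j k @ da i k @ da i j) | i j k.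
       {i, j, k} \<subseteq> {1..n} \<and> distinct [i, j, k]}
  \<union> {(tau i @ tau i, []) | i. i \<in> {1..n}}
  \<union> {(tau i @ tau j, tau j @ tau i) | i j. {i, j} \<subseteq> {1..n}}
  \<union> {(tau i @ tau j @ da i j @ tau j @ tau i, da i j) | i j. {i, j} \<subseteq> {1..n} \<and> i \<noteq> j}
  \<union> {(da i j @ tau k, tau k @ da i j) | i j k.
       {i, j, k} \<subseteq> {1..n} \<and> distinct [i, j, k]}"

definition G2d :: "nat \<Rightarrow> dgen word set monoid" where
  "G2d n = presented_group (Gd_gens n) (Gd_rels n)"

text \<open>
  The number of letters \<open>\<tau>\<^sub>i\<close> or \<open>\<tau>\<^sub>i\<inverse>\<close> in a word; the two are equal in the group.
\<close>

definition tau_count :: "nat \<Rightarrow> dgen word \<Rightarrow> nat" where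
  "tau_count i w = length (filter (\<lambda>l. fst l = Tau i) w)"

text \<open>
  An element of \<^term>\<open>G2d n\<close> is the set of all words representing it. The parity of
  \<^const>\<open>tau_count\<close> is constant on this set, see \<open>even_tau_count_class\<close> below.
\<close>

definition H2d :: "nat \<Rightarrow> dgen word set set" where
  "H2d n = {\<beta> \<in> carrier (G2d n). \<forall>i\<in>{1..n}. \<forall>w\<in>\<beta>. even (tau_count i w)}"

lemma tau_count_append [simp]: "tau_count i (u @ v) = tau_count i u + tau_count i v"
  by (simp add: tau_count_def)

lemma even_tau_count_cong:
  "(u, v) \<in> word_cong (Gd_gens n) (Gd_rels n) \<Longrightarrow> even (tau_count i u) \<longleftrightarrow> even (tau_count i v)"
proof (induction rule: word_cong.induct)
  case (cancel x b)
  then show ?case by (simp add: tau_count_def)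
next
  case (relation u v)
  from relation(1) show ?case
    unfolding Gd_rels_def by (elim UnE CollectE exE conjE) (auto simp: tau_count_def)
qed auto

lemma even_tau_count_class:
  assumes "\<beta> \<in> carrier (G2d n)" "u \<in> \<beta>" "v \<in> \<beta>"
  shows "even (tau_count i u) \<longleftrightarrow> even (tau_count i v)"
proof -
  from assms(1) obtain w where "\<beta> = word_cong (Gd_gens n) (Gd_rels n) `` {w}"
    by (auto simp: G2d_def word_class_def elim!: carrier_presented_groupE)
  with assms(2,3) have "even (tau_count i w) \<longleftrightarrow> even (tau_count i u)"
    "even (tau_count i w) \<longleftrightarrow> even (tau_count i v)"
    by (auto intro!: even_tau_count_cong)
  then show ?thesis by simp
qed

lemma word_class_in_H2d_iff:
  assumes "w \<in> words (Gd_gens n)"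
  shows "word_class (Gd_gens n) (Gd_rels n) w \<in> H2d n \<longleftrightarrow> (\<forall>i\<in>{1..n}. even (tau_count i w))"
proof -
  let ?C = "word_class (Gd_gens n) (Gd_rels n) w"
  have C: "?C \<in> carrier (G2d n)"
    unfolding G2d_def by (rule word_class_in_carrier[OF assms])
  have w: "w \<in> ?C"
    using assms by (simp add: word_class_def word_cong.refl)
  show ?thesis
    unfolding H2d_def using C w even_tau_count_class[OF C _ w] by blast
qed

theorem subgroup_H2d: "subgroup (H2d n) (G2d n)"
proof -
  interpret G: group "G2d n"
    unfolding G2d_def by (rule group_presented_group)
  let ?c = "word_class (Gd_gens n) (Gd_rels n)"
  have E: "\<exists>w. w \<in> words (Gd_gens n) \<and> X = ?c w \<and> (\<forall>i\<in>{1..n}. even (tau_count i w))"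
    if "X \<in> H2d n" for X
  proof -
    from that have "X \<in> carrier (presented_group (Gd_gens n) (Gd_rels n))"
      by (simp add: H2d_def G2d_def)
    then obtain w where "w \<in> words (Gd_gens n)" "X = ?c w"
      by (rule carrier_presented_groupE)
    with that word_class_in_H2d_iff show ?thesis by blast
  qed
  have one: "\<one>\<^bsub>G2d n\<^esub> \<in> H2d n"
    by (simp add: G2d_def one_presented_group word_class_in_H2d_iff) (simp add: tau_count_def)
  show ?thesis
  proof (rule G.subgroupI)
    show "H2d n \<subseteq> carrier (G2d n)" by (auto simp: H2d_def)
    show "H2d n \<noteq> {}" using one by blast
  next
    fix X assume X: "X \<in> H2d n"
    then obtain w where w: "w \<in> words (Gd_gens n)" "X = ?c w" "\<forall>i\<in>{1..n}. even (tau_count i w)"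
      using E by blast
    have "?c (inv_word w) \<otimes>\<^bsub>G2d n\<^esub> X = \<one>\<^bsub>G2d n\<^esub>"
      using w by (simp add: G2d_def mult_presented_group one_presented_group inv_word_words
          word_class_eq_iff inv_word_cancel)
    moreover have "X \<in> carrier (G2d n)" "?c (inv_word w) \<in> carrier (G2d n)"
      using w by (simp_all add: G2d_def word_class_in_carrier inv_word_words)
    ultimately have "inv\<^bsub>G2d n\<^esub> X = ?c (inv_word w)"
      by (rule G.inv_equality)
    moreover have "tau_count i (inv_word w) = tau_count i w" for i
      by (induction w) (auto simp: tau_count_def inv_word_def)
    ultimately show "inv\<^bsub>G2d n\<^esub> X \<in> H2d n"
      using w by (simp add: word_class_in_H2d_iff inv_word_words)
  next
    fix X Y assume "X \<in> H2d n" "Y \<in> H2d n"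
    then obtain u v where "u \<in> words (Gd_gens n)" "X = ?c u" "\<forall>i\<in>{1..n}. even (tau_count i u)"
      "v \<in> words (Gd_gens n)" "Y = ?c v" "\<forall>i\<in>{1..n}. even (tau_count i v)"
      using E by meson
    then show "X \<otimes>\<^bsub>G2d n\<^esub> Y \<in> H2d n"
      by (simp add: G2d_def mult_presented_group word_class_in_H2d_iff)
  qed
qed

end

theory Submission
  imports Defs
begin

text \<open>
  The isomorphism sends \<open>a\<^sub>i\<^sub>j\<close> with label \<open>0\<close> to \<open>a\<^sub>i\<^sub>j\<close>, and with label \<open>1\<close> to \<open>\<tau>\<^sub>i a\<^sub>i\<^sub>j \<tau>\<^sub>i\<close>. Its inverse
  deletes the points from a word and labels each \<open>a\<^sub>i\<^sub>j\<close> by the parity of the number of letters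
  \<open>\<tau>\<^sub>i\<close> and \<open>\<tau>\<^sub>j\<close> in front of it. Moving all points of a word to its right end turns it into the image
  of the labelled word followed by a word in the commuting involutions \<open>\<tau>\<^sub>i\<close>, and the latter is
  trivial for elements of the subgroup.
\<close>

section \<open>Congruences on words\<close>

lemmas [trans] = word_cong.trans

text \<open>One rewriting step inside a word. The context \<open>a\<close>, \<open>b\<close> is
  given explicitly at each use because a word may split in several ways;
  \<open>x \<in> words S\<close> supplies reflexivity on the context.\<close>

lemma word_cong_step:
  assumes "(l, r) \<in> word_cong S R" "x = a @ l @ b" "y = a @ r @ b" "x \<in> words S"
  shows "(x, y) \<in> word_cong S R"
  using assms by (auto intro!: word_cong.append intro: word_cong.refl)

text \<open>Realizing labels and then forgetting points loses the inverse marks, so a word comes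
  back only in this form. It is congruent to the original word when the generators are
  involutions.\<close>

definition positive :: "'g word \<Rightarrow> 'g word" where
  "positive = map (\<lambda>l. (fst l, False))"

lemma positive_simps [simp]:
  "positive [] = []" "positive ((x, b) # w) = (x, False) # positive w"
  by (simp_all add: positive_def)

text \<open>If x x = 1, then x^-1 = x^-1 x x = x.\<close>

lemma letter_cong_positive:
  assumes x: "x \<in> S" and sq: "([(x, False), (x, False)], []) \<in> word_cong S R"
  shows "([(x, b)], [(x, False)]) \<in> word_cong S R"
proof (cases b)
  case True
  have "([(x, True)], [(x, True), (x, False), (x, False)]) \<in> word_cong S R" (is "(_, ?x) \<in> _")
    by (rule word_cong_step[OF word_cong.sym[OF sq], where a = "[(x, True)]" and b = "[]"])
      (use x in auto)
  also have "(?x, [(x, False)]) \<in> word_cong S R"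
    by (rule word_cong_step[OF word_cong.cancel[OF x, where b = True],
          where a = "[]" and b = "[(x, False)]"]) (use x in auto)
  finally show ?thesis using True by simp
qed (use x in \<open>auto intro: word_cong.refl\<close>)

lemma word_cong_positive:
  assumes sq: "\<And>x. x \<in> S \<Longrightarrow> ([(x, False), (x, False)], []) \<in> word_cong S R"
    and "w \<in> words S"
  shows "(w, positive w) \<in> word_cong S R"
  using assms(2)
proof (induction w)
  case (Cons l w)
  obtain x b where l: "l = (x, b)" by fastforce
  with Cons have "([(x, b)] @ w, [(x, False)] @ positive w) \<in> word_cong S R"
    by (intro word_cong.append letter_cong_positive sq) auto
  then show ?case by (simp add: l)
qed (auto intro: word_cong.refl)

text \<open>The implication from right to left in \<open>cong\<close> makes the induced map on
  classes well defined, the converse makes it injective, and \<open>H\<close> is its image by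
  assumption.\<close>

lemma presented_group_iso:
  fixes h :: "'g word \<Rightarrow> 'h word"
  assumes words: "\<And>w. w \<in> words S \<Longrightarrow> h w \<in> words S'"
    and append: "\<And>u v. h (u @ v) = h u @ h v"
    and cong: "\<And>u v. u \<in> words S \<Longrightarrow> v \<in> words S \<Longrightarrow>
      (h u, h v) \<in> word_cong S' R' \<longleftrightarrow> (u, v) \<in> word_cong S R"
    and H: "H = (\<lambda>w. word_class S' R' (h w)) ` words S"
  shows "presented_group S R \<cong> (presented_group S' R')\<lparr>carrier := H\<rparr>"
proof -
  define \<Phi> where "\<Phi> X = word_class S' R' (h (SOME w. w \<in> X))" for X
  have \<Phi>: "\<Phi> (word_class S R w) = word_class S' R' (h w)" if w: "w \<in> words S" for w
  proof -
    have "w \<in> word_class S R w"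
      using w by (simp add: word_class_def word_cong.refl)
    then have "(SOME v. v \<in> word_class S R w) \<in> word_class S R w"
      by (rule someI)
    then have c: "(w, SOME v. v \<in> word_class S R w) \<in> word_cong S R"
      by (simp add: word_class_def)
    then have "(SOME v. v \<in> word_class S R w) \<in> words S"
      by (blast dest: word_cong_words)
    then show ?thesis
      using c w by (simp add: \<Phi>_def word_class_eq_iff words cong word_cong.sym)
  qed
  have "\<Phi> \<in> hom (presented_group S R) ((presented_group S' R')\<lparr>carrier := H\<rparr>)"
  proof (rule homI)
    fix X assume "X \<in> carrier (presented_group S R)"
    then show "\<Phi> X \<in> carrier ((presented_group S' R')\<lparr>carrier := H\<rparr>)"
      by (elim carrier_presented_groupE) (auto simp: \<Phi> H)
  next
    fix X Y assume "X \<in> carrier (presented_group S R)" "Y \<in> carrier (presented_group S R)"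
    then show "\<Phi> (X \<otimes>\<^bsub>presented_group S R\<^esub> Y) =
        \<Phi> X \<otimes>\<^bsub>(presented_group S' R')\<lparr>carrier := H\<rparr>\<^esub> \<Phi> Y"
      by (elim carrier_presented_groupE) (simp add: mult_presented_group \<Phi> words append)
  qed
  moreover have "inj_on \<Phi> (carrier (presented_group S R))"
    by (intro inj_onI, elim carrier_presented_groupE) (simp add: \<Phi> word_class_eq_iff words cong)
  moreover have "\<Phi> ` carrier (presented_group S R) = H"
  proof -
    have "carrier (presented_group S R) = word_class S R ` words S"
      by (auto elim: carrier_presented_groupE intro: word_class_in_carrier)
    then show ?thesis by (simp add: H image_image \<Phi> cong: image_cong)
  qed
  ultimately show ?thesis
    unfolding is_iso_def iso_def bij_betw_def by auto
qed


section \<open>The defining relations\<close>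

text \<open>Since {i, j} = {j, i}, the ordering in \<open>Gp_gens\<close> amounts to i \<noteq> j,
  which lets relations be used with their indices in any order.\<close>

lemma PA_in_Gp_gens [simp]:
  "PA {i, j} \<epsilon> \<in> Gp_gens n \<longleftrightarrow> i \<in> {1..n} \<and> j \<in> {1..n} \<and> i \<noteq> j \<and> \<epsilon> \<in> {0, 1}"
  unfolding Gp_gens_def by (auto simp: doubleton_eq_iff) (metis nat_neq_iff)+

lemma DA_in_Gd_gens [simp]:
  "DA {i, j} \<in> Gd_gens n \<longleftrightarrow> i \<in> {1..n} \<and> j \<in> {1..n} \<and> i \<noteq> j"
  unfolding Gd_gens_def by (auto simp: doubleton_eq_iff) (metis nat_neq_iff)+

lemma Tau_in_Gd_gens [simp]: "Tau i \<in> Gd_gens n \<longleftrightarrow> i \<in> {1..n}"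
  by (auto simp: Gd_gens_def)

lemma Gp_gensE:
  assumes "x \<in> Gp_gens n"
  obtains i j \<epsilon> where "x = PA {i, j} \<epsilon>" "i \<in> {1..n}" "j \<in> {1..n}" "i < j" "\<epsilon> \<in> {0, 1}"
  using assms unfolding Gp_gens_def by blast

lemma Gd_gensE:
  assumes "x \<in> Gd_gens n"
  obtains i j where "x = DA {i, j}" "i \<in> {1..n}" "j \<in> {1..n}" "i < j"
  | i where "x = Tau i" "i \<in> {1..n}"
  using assms unfolding Gd_gens_def by blast

abbreviation p_cong :: "nat \<Rightarrow> (pgen word \<times> pgen word) set" where
  "p_cong n \<equiv> word_cong (Gp_gens n) (Gp_rels n)"

abbreviation d_cong :: "nat \<Rightarrow> (dgen word \<times> dgen word) set" where
  "d_cong n \<equiv> word_cong (Gd_gens n) (Gd_rels n)"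

lemma p_square:
  assumes "i \<in> {1..n}" "j \<in> {1..n}" "i \<noteq> j" "\<epsilon> \<in> {0, 1}"
  shows "(pa i j \<epsilon> @ pa i j \<epsilon>, []) \<in> p_cong n"
proof (rule word_cong.relation)
  show "(pa i j \<epsilon> @ pa i j \<epsilon>, []) \<in> Gp_rels n"
    unfolding Gp_rels_def using assms by (simp only: Un_iff) blast
qed (use assms in auto)

lemma p_commute:
  assumes "{i, j, k, l} \<subseteq> {1..n}" "distinct [i, j, k, l]" "{\<epsilon>, \<epsilon>'} \<subseteq> {0, 1}"
  shows "(pa i j \<epsilon> @ pa k l \<epsilon>', pa k l \<epsilon>' @ pa i j \<epsilon>) \<in> p_cong n"
proof (rule word_cong.relation)
  show "(pa i j \<epsilon> @ pa k l \<epsilon>', pa k l \<epsilon>' @ pa i j \<epsilon>) \<in> Gp_rels n"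
    unfolding Gp_rels_def using assms by (simp only: Un_iff) blast
qed (use assms in auto)

lemma p_triangle:
  assumes "{i, j, k} \<subseteq> {1..n}" "distinct [i, j, k]" "{\<epsilon>, \<epsilon>', \<epsilon>''} \<subseteq> {0, 1}"
    "even (\<epsilon> + \<epsilon>' + \<epsilon>'')"
  shows "(pa i j \<epsilon> @ pa i k \<epsilon>' @ pa j k \<epsilon>'', pa j k \<epsilon>'' @ pa i k \<epsilon>' @ pa i j \<epsilon>) \<in> p_cong n"
proof (rule word_cong.relation)
  show "(pa i j \<epsilon> @ pa i k \<epsilon>' @ pa j k \<epsilon>'', pa j k \<epsilon>'' @ pa i k \<epsilon>' @ pa i j \<epsilon>) \<in> Gp_rels n"
    unfolding Gp_rels_def using assms by (simp only: Un_iff) blast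
qed (use assms in auto)

lemma d_square:
  assumes "i \<in> {1..n}" "j \<in> {1..n}" "i \<noteq> j"
  shows "(da i j @ da i j, []) \<in> d_cong n"
proof (rule word_cong.relation)
  show "(da i j @ da i j, []) \<in> Gd_rels n"
    unfolding Gd_rels_def using assms by (simp only: Un_iff) blast
qed (use assms in auto)

lemma d_commute:
  assumes "{i, j, k, l} \<subseteq> {1..n}" "distinct [i, j, k, l]"
  shows "(da i j @ da k l, da k l @ da i j) \<in> d_cong n"
proof (rule word_cong.relation)
  show "(da i j @ da k l, da k l @ da i j) \<in> Gd_rels n"
    unfolding Gd_rels_def using assms by (simp only: Un_iff) blast
qed (use assms in auto)

lemma d_triangle:
  assumes "{i, j, k} \<subseteq> {1..n}" "distinct [i, j, k]"
  shows "(da i j @ da i k @ da j k, da j k @ da i k @ da i j) \<in> d_cong n"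
proof (rule word_cong.relation)
  show "(da i j @ da i k @ da j k, da j k @ da i k @ da i j) \<in> Gd_rels n"
    unfolding Gd_rels_def using assms by (simp only: Un_iff) blast
qed (use assms in auto)

lemma tau_square:
  assumes "i \<in> {1..n}"
  shows "(tau i @ tau i, []) \<in> d_cong n"
proof (rule word_cong.relation)
  show "(tau i @ tau i, []) \<in> Gd_rels n"
    unfolding Gd_rels_def using assms by (simp only: Un_iff) blast
qed (use assms in auto)

lemma tau_commute:
  assumes "i \<in> {1..n}" "j \<in> {1..n}"
  shows "(tau i @ tau j, tau j @ tau i) \<in> d_cong n"
proof (rule word_cong.relation)
  show "(tau i @ tau j, tau j @ tau i) \<in> Gd_rels n"
    unfolding Gd_rels_def using assms by (simp only: Un_iff) blast
qed (use assms in auto)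

lemma tau_tau_conj:
  assumes "i \<in> {1..n}" "j \<in> {1..n}" "i \<noteq> j"
  shows "(tau i @ tau j @ da i j @ tau j @ tau i, da i j) \<in> d_cong n"
proof (rule word_cong.relation)
  show "(tau i @ tau j @ da i j @ tau j @ tau i, da i j) \<in> Gd_rels n"
    unfolding Gd_rels_def using assms by (simp only: Un_iff) blast
qed (use assms in auto)

lemma da_tau_commute:
  assumes "{i, j, k} \<subseteq> {1..n}" "distinct [i, j, k]"
  shows "(da i j @ tau k, tau k @ da i j) \<in> d_cong n"
proof (rule word_cong.relation)
  show "(da i j @ tau k, tau k @ da i j) \<in> Gd_rels n"
    unfolding Gd_rels_def using assms by (simp only: Un_iff) blast
qed (use assms in auto)

lemma p_cong_positive: "w \<in> words (Gp_gens n) \<Longrightarrow> (w, positive w) \<in> p_cong n"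
  by (rule word_cong_positive) (auto elim!: Gp_gensE dest: p_square)

lemma d_letter_cong_positive:
  "x \<in> Gd_gens n \<Longrightarrow> ([(x, b)], [(x, False)]) \<in> d_cong n"
  by (rule letter_cong_positive) (auto elim!: Gd_gensE dest: d_square tau_square)


section \<open>Forgetting the points\<close>

text \<open>Counting marked indices in a set avoids choosing an order of the endpoints; on a pair
  the label is the exclusive or of the two marks.\<close>

definition label :: "(nat \<Rightarrow> bool) \<Rightarrow> nat set \<Rightarrow> nat" where
  "label s p = of_bool (odd (card {i \<in> p. s i}))"

lemma label_pair: "i \<noteq> j \<Longrightarrow> label s {i, j} = of_bool (s i \<noteq> s j)"
proof -
  assume "i \<noteq> j"
  have "{x \<in> {i, j}. s x} = (if s i then {i} else {}) \<union> (if s j then {j} else {})"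
    by auto
  then show ?thesis
    using \<open>i \<noteq> j\<close> by (simp add: label_def)
qed

lemma label_in [simp]: "label s p = 0 \<or> label s p = Suc 0"
  by (simp add: label_def)

text \<open>The state \<open>s\<close> records the indices of the points that have been passed an odd number of times. Inverse
  marks can be dropped, since all generators are involutions.\<close>

fun forget_points :: "(nat \<Rightarrow> bool) \<Rightarrow> dgen word \<Rightarrow> pgen word" where
  "forget_points s [] = []"
| "forget_points s ((DA p, b) # w) = (PA p (label s p), False) # forget_points s w"
| "forget_points s ((Tau k, b) # w) = forget_points (s(k := \<not> s k)) w"

lemma tau_count_simps [simp]:
  "tau_count i [] = 0"
  "tau_count i ((DA p, b) # w) = tau_count i w"
  "tau_count i ((Tau k, b) # w) = of_bool (k = i) + tau_count i w"
  by (simp_all add: tau_count_def)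

text \<open>Each letter \<open>Tau i\<close> of \<open>u\<close>, inverted or not, flips the mark of
  i, so \<open>v\<close> is read in the state that differs from \<open>s\<close> by the parities of
  the counts in \<open>u\<close>.\<close>

lemma forget_points_append:
  "forget_points s (u @ v) = forget_points s u @ forget_points (\<lambda>i. s i \<noteq> odd (tau_count i u)) v"
proof (induction s u rule: forget_points.induct)
  case (3 s k b w)
  have "(\<lambda>i. (s(k := \<not> s k)) i \<noteq> odd (tau_count i w)) =
      (\<lambda>i. s i \<noteq> odd (tau_count i ((Tau k, b) # w)))"
    by auto
  with 3 show ?case by (simp only: append_Cons forget_points.simps)
qed simp_all

lemma forget_points_words:
  "w \<in> words (Gd_gens n) \<Longrightarrow> forget_points s w \<in> words (Gp_gens n)"
  by (induction s w rule: forget_points.induct) (auto elim!: Gd_gensE)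

text \<open>In a triangle each of the marks of i, j, k enters two of the three labels, so their sum
  is even, which is the parity condition in \<open>Gp_rels\<close>.\<close>

lemma forget_points_relation:
  assumes "(u, v) \<in> Gd_rels n"
  shows "(forget_points s u, forget_points s v) \<in> p_cong n"
  using assms unfolding Gd_rels_def
proof (elim UnE CollectE exE conjE, goal_cases)
  case (1 i j)
  then show ?case using p_square[of i n j "label s {i, j}"] by simp
next
  case (2 i j k l)
  then show ?case using p_commute[of i j k l n "label s {i, j}" "label s {k, l}"] by simp
next
  case (3 i j k)
  then show ?case
    using p_triangle[of i j k n "label s {i, j}" "label s {i, k}" "label s {j, k}"]
    by (simp add: label_pair)
\<comment> \<open>For the relations with points both sides give the same word: flipping both ends of
  a pair keeps its label, and a point off the pair does not affect it.\<close>
qed (auto simp: label_pair fun_upd_twist intro!: word_cong.refl)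

text \<open>The state has to be arbitrary, since the second factor of a product starts from the
  state left by the first. Congruent first factors leave the same state by
  \<open>even_tau_count_cong\<close>.\<close>

lemma forget_points_cong:
  assumes "(u, v) \<in> d_cong n"
  shows "(forget_points s u, forget_points s v) \<in> p_cong n"
  using assms
proof (induction arbitrary: s rule: word_cong.induct)
  case (append u u' v v')
  then show ?case
    using even_tau_count_cong[OF append.hyps(1)]
    by (auto simp: forget_points_append intro!: word_cong.append)
next
  case (cancel x b)
  then show ?case
    by (auto elim!: Gd_gensE intro!: word_cong.refl simp: p_square[simplified])
qed (auto intro: word_cong.intros forget_points_words forget_points_relation)


section \<open>Realizing labels by points\<close>

text \<open>The smaller endpoint is a choice of representative: by \<open>tau_tau_conj\<close>,
  conjugation by the larger endpoint gives the same group element.\<close>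

abbreviation point_conj :: "nat set \<Rightarrow> nat \<Rightarrow> dgen word" where
  "point_conj p \<epsilon> \<equiv>
    (if \<epsilon> = 0 then [(DA p, False)] else tau (Min p) @ [(DA p, False)] @ tau (Min p))"

fun add_points :: "pgen word \<Rightarrow> dgen word" where
  "add_points [] = []"
| "add_points ((PA p \<epsilon>, b) # w) = point_conj p \<epsilon> @ add_points w"

lemma add_points_append: "add_points (u @ v) = add_points u @ add_points v"
  by (induction u rule: add_points.induct) simp_all

lemma add_points_words: "w \<in> words (Gp_gens n) \<Longrightarrow> add_points w \<in> words (Gd_gens n)"
  by (induction w rule: add_points.induct) (auto elim!: Gp_gensE)

text \<open>At a letter labelled 1 the first point marks one endpoint, so the pair is read with
  label 1, and the second point removes the mark. The state between letters is therefore always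
  empty.\<close>

lemma forget_add_points:
  "w \<in> words (Gp_gens n) \<Longrightarrow> forget_points (\<lambda>_. False) (add_points w) = positive w"
proof (induction w rule: add_points.induct)
  case (2 p \<epsilon> b w)
  then obtain i j where "p = {i, j}" "i < j" "\<epsilon> \<in> {0, 1}"
    by (auto elim: Gp_gensE)
  with 2 show ?case
    by (auto simp: label_pair fun_upd_def)
qed simp

section \<open>Products of points and their commutation rules\<close>

definition points :: "nat list \<Rightarrow> dgen word" where
  "points = map (\<lambda>k. (Tau k, False))"

lemma points_simps [simp]:
  "points [] = []" "points (k # ks) = (Tau k, False) # points ks"
  "points (ks @ ls) = points ks @ points ls"
  by (simp_all add: points_def)

lemma points_words [simp]: "points ks \<in> words (Gd_gens n) \<longleftrightarrow> set ks \<subseteq> {1..n}"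
  by (induction ks) auto

lemma tau_points_commute:
  assumes "k \<in> {1..n}" "set ks \<subseteq> {1..n}"
  shows "((Tau k, False) # points ks, points ks @ tau k) \<in> d_cong n"
  using assms(2)
proof (induction ks)
  case Nil
  then show ?case using assms(1) by (auto intro: word_cong.refl)
next
  case (Cons l ks)
  have "((Tau k, False) # points (l # ks), (Tau l, False) # (Tau k, False) # points ks) \<in> d_cong n" (is "(_, ?x) \<in> _")
    by (rule word_cong_step[OF tau_commute[of k n l], where a = "[]" and b = "points ks"])
      (use assms Cons in auto)
  also have "(?x, points (l # ks) @ tau k) \<in> d_cong n"
    by (rule word_cong_step[OF Cons.IH, where a = "tau l" and b = "[]"])
      (use assms Cons in auto)
  finally show ?case .
qed

text \<open>Induction on the length: the first letter recurs, can be moved next to a later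
  occurrence and cancels with it.\<close>

lemma points_even:
  assumes "set ks \<subseteq> {1..n}" "\<And>i. even (count_list ks i)"
  shows "(points ks, []) \<in> d_cong n"
  using assms
proof (induction "length ks" arbitrary: ks rule: less_induct)
  case less
  show ?case
  proof (cases ks)
    case Nil
    then show ?thesis by (auto intro: word_cong.refl)
  next
    case (Cons k ls)
    \<comment> \<open>An even count of \<open>k\<close> in \<open>k # ls\<close> means an odd, hence
      nonzero, count in \<open>ls\<close>.\<close>
    with less.prems(2)[of k] have "k \<in> set ls"
      by (auto simp: count_list_0_iff intro: ccontr)
    then obtain xs ys where ls: "ls = xs @ k # ys"
      by (meson split_list)
    have "(points ks, points xs @ tau k @ tau k @ points ys) \<in> d_cong n" (is "(_, ?x) \<in> _")
      by (rule word_cong_step[OF tau_points_commute[of k n xs], where a = "[]" and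
            b = "tau k @ points ys"]) (use less.prems Cons ls in auto)
    also have "(?x, points (xs @ ys)) \<in> d_cong n" (is "(_, ?x) \<in> _")
      by (rule word_cong_step[OF tau_square[of k], where a = "points xs" and b = "points ys"])
        (use less.prems Cons ls in auto)
    also have "(?x, []) \<in> d_cong n"
    proof (rule less.hyps)
      show "even (count_list (xs @ ys) i)" for i
        using less.prems(2)[of i] by (auto simp: Cons ls split: if_splits)
    qed (use less.prems Cons ls in auto)
    finally show ?thesis .
  qed
qed

text \<open>The reversed list gives an inverse: in \<open>ks @ rev ks\<close> every index occurs an
  even number of times, so \<open>points_even\<close> applies.\<close>

lemma points_cancel_right:
  assumes uv: "(u @ points ks, v @ points ks) \<in> d_cong n"
  shows "(u, v) \<in> d_cong n"
proof -
  have w: "u \<in> words (Gd_gens n)" "v \<in> words (Gd_gens n)" "set ks \<subseteq> {1..n}"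
    using word_cong_words[OF uv] by auto
  have e: "(points (ks @ rev ks), []) \<in> d_cong n"
    by (rule points_even) (use w in auto)
  have "(u, u @ points (ks @ rev ks)) \<in> d_cong n" (is "(_, ?x) \<in> _")
    by (rule word_cong_step[OF word_cong.sym[OF e], where a = u and b = "[]"]) (use w in auto)
  also have "(?x, v @ points (ks @ rev ks)) \<in> d_cong n" (is "(_, ?x) \<in> _")
    by (rule word_cong_step[OF uv, where a = "[]" and b = "points (rev ks)"]) (use w in auto)
  also have "(?x, v) \<in> d_cong n"
    by (rule word_cong_step[OF e, where a = v and b = "[]"]) (use w in auto)
  finally show ?thesis .
qed

text \<open>For \<open>k = i\<close> it suffices to insert or delete a square. For
  \<open>k = j\<close> the relation \<open>tau_tau_conj\<close> exchanges conjugation by the two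
  endpoints. A point off the pair commutes with every letter involved.\<close>

lemma tau_point_conj:
  assumes ij: "i \<in> {1..n}" "j \<in> {1..n}" "i < j" and k: "k \<in> {1..n}" and "\<epsilon> \<in> {0, 1}"
  shows "(tau k @ point_conj {i, j} \<epsilon>,
    point_conj {i, j} (if k \<in> {i, j} then 1 - \<epsilon> else \<epsilon>) @ tau k) \<in> d_cong n"
proof -
  let ?a = "(DA {i, j}, False)" and ?t = "\<lambda>k. (Tau k, False)"
  have m: "Min {i, j} = i" using ij by simp
  note ii = tau_square[OF ij(1)] and jj = tau_square[OF ij(2)]
  note iji = tau_tau_conj[OF ij(1,2) less_imp_neq[OF ij(3)]]
  consider "k = i" "\<epsilon> = 0" | "k = i" "\<epsilon> = 1" | "k = j" "\<epsilon> = 0" | "k = j" "\<epsilon> = 1"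
    | "k \<notin> {i, j}" "\<epsilon> = 0" | "k \<notin> {i, j}" "\<epsilon> = 1"
    using assms by blast
  then show ?thesis
  proof cases
    case 1
    have "([?t i, ?a], [?t i, ?a, ?t i, ?t i]) \<in> d_cong n"
      by (rule word_cong_step[OF word_cong.sym[OF ii], where a = "[?t i, ?a]" and b = "[]"])
        (use ij in auto)
    with 1 m show ?thesis by simp
  next
    case 2
    have "([?t i, ?t i, ?a, ?t i], [?a, ?t i]) \<in> d_cong n"
      by (rule word_cong_step[OF ii, where a = "[]" and b = "[?a, ?t i]"]) (use ij in auto)
    with 2 m show ?thesis by simp
  next
    case 3
    \<comment> \<open>Inserting three squares creates the left side of \<open>tau_tau_conj\<close>,
      preceded by \<open>?t i\<close> and followed by \<open>?t i\<close>,
      \<open>?t j\<close>.\<close>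
    have "([?t j, ?a], [?t i, ?t i, ?t j, ?a]) \<in> d_cong n" (is "(_, ?x) \<in> _")
      by (rule word_cong_step[OF word_cong.sym[OF ii], where a = "[]" and b = "[?t j, ?a]"])
        (use ij in auto)
    also have "(?x, [?t i, ?t i, ?t j, ?a, ?t j, ?t j]) \<in> d_cong n" (is "(_, ?x) \<in> _")
      by (rule word_cong_step[OF word_cong.sym[OF jj],
            where a = "[?t i, ?t i, ?t j, ?a]" and b = "[]"]) (use ij in auto)
    also have "(?x, [?t i, ?t i, ?t j, ?a, ?t j, ?t i, ?t i, ?t j]) \<in> d_cong n" (is "(_, ?x) \<in> _")
      by (rule word_cong_step[OF word_cong.sym[OF ii],
            where a = "[?t i, ?t i, ?t j, ?a, ?t j]" and b = "[?t j]"]) (use ij in auto)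
    also have "(?x, [?t i, ?a, ?t i, ?t j]) \<in> d_cong n"
      by (rule word_cong_step[OF iji, where a = "[?t i]" and b = "[?t i, ?t j]"])
        (use ij in auto)
    finally show ?thesis using 3 m by simp
  next
    case 4
    \<comment> \<open>Reordering points and inserting the square of \<open>?t j\<close> completes
      the left side of \<open>tau_tau_conj\<close>, with one \<open>?t j\<close> left over.\<close>
    have "([?t j, ?t i, ?a, ?t i], [?t i, ?t j, ?a, ?t i]) \<in> d_cong n" (is "(_, ?x) \<in> _")
      by (rule word_cong_step[OF tau_commute[OF ij(2,1)], where a = "[]" and b = "[?a, ?t i]"])
        (use ij in auto)
    also have "(?x, [?t i, ?t j, ?a, ?t j, ?t j, ?t i]) \<in> d_cong n" (is "(_, ?x) \<in> _")
      by (rule word_cong_step[OF word_cong.sym[OF jj],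
            where a = "[?t i, ?t j, ?a]" and b = "[?t i]"]) (use ij in auto)
    also have "(?x, [?t i, ?t j, ?a, ?t j, ?t i, ?t j]) \<in> d_cong n" (is "(_, ?x) \<in> _")
      by (rule word_cong_step[OF tau_commute[OF ij(2,1)],
            where a = "[?t i, ?t j, ?a, ?t j]" and b = "[]"]) (use ij in auto)
    also have "(?x, [?a, ?t j]) \<in> d_cong n"
      by (rule word_cong_step[OF iji, where a = "[]" and b = "[?t j]"]) (use ij in auto)
    finally show ?thesis using 4 m by simp
  next
    case 5
    with ij k have "(tau k @ [?a], [?a] @ tau k) \<in> d_cong n"
      by (intro word_cong.sym[OF da_tau_commute]) auto
    with 5 show ?thesis by simp
  next
    case 6
    have ak: "(tau k @ [?a], [?a] @ tau k) \<in> d_cong n"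
      using 6 ij k by (intro word_cong.sym[OF da_tau_commute]) auto
    have "([?t k, ?t i, ?a, ?t i], [?t i, ?t k, ?a, ?t i]) \<in> d_cong n" (is "(_, ?x) \<in> _")
      by (rule word_cong_step[OF tau_commute[OF k ij(1)], where a = "[]" and b = "[?a, ?t i]"])
        (use ij k in auto)
    also have "(?x, [?t i, ?a, ?t k, ?t i]) \<in> d_cong n" (is "(_, ?x) \<in> _")
      by (rule word_cong_step[OF ak, where a = "[?t i]" and b = "[?t i]"]) (use ij k in auto)
    also have "(?x, [?t i, ?a, ?t i, ?t k]) \<in> d_cong n"
      by (rule word_cong_step[OF tau_commute[OF k ij(1)], where a = "[?t i, ?a]" and b = "[]"])
        (use ij k in auto)
    finally show ?thesis using 6 m by simp
  qed
qed

section \<open>Collecting the points at the right end of a word\<close>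

abbreviation odd_points :: "nat list \<Rightarrow> nat \<Rightarrow> bool" where
  "odd_points ks \<equiv> (\<lambda>i. odd (count_list ks i))"

text \<open>The points pass the pair one by one, starting with the last. Each endpoint among them
  toggles the label by \<open>tau_point_conj\<close>, so only the parities of their counts
  matter.\<close>

lemma points_DA:
  assumes ij: "i \<in> {1..n}" "j \<in> {1..n}" "i < j" and "set ks \<subseteq> {1..n}"
  shows "(points ks @ da i j, point_conj {i, j} (label (odd_points ks) {i, j}) @ points ks)
    \<in> d_cong n"
  using assms(4)
proof (induction ks)
  case Nil
  then show ?case using ij by (auto simp: label_pair intro: word_cong.refl)
next
  case (Cons k ks)
  let ?l = "\<lambda>ks. label (odd_points ks) {i, j}"
  have l: "?l (k # ks) = (if k \<in> {i, j} then 1 - ?l ks else ?l ks)"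
    using ij by (auto simp: label_pair)
  have "(points (k # ks) @ da i j, tau k @ point_conj {i, j} (?l ks) @ points ks) \<in> d_cong n" (is "(_, ?x) \<in> _")
    by (rule word_cong_step[OF Cons.IH, where a = "tau k" and b = "[]"])
      (use Cons.prems ij in auto)
  also have "(?x, point_conj {i, j} (?l (k # ks)) @ points (k # ks)) \<in> d_cong n"
    unfolding l
    by (rule word_cong_step[OF tau_point_conj[of i n j k "?l ks"], where a = "[]" and
          b = "points ks"]) (use Cons.prems ij in auto)
  finally show ?case .
qed

fun points_of :: "dgen word \<Rightarrow> nat list" where
  "points_of [] = []"
| "points_of ((DA p, b) # w) = points_of w"
| "points_of ((Tau k, b) # w) = k # points_of w"

lemma count_points_of: "count_list (points_of w) i = tau_count i w"
  by (induction w rule: points_of.induct) auto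

lemma points_of_words: "w \<in> words (Gd_gens n) \<Longrightarrow> set (points_of w) \<subseteq> {1..n}"
  by (induction w rule: points_of.induct) auto

text \<open>The list \<open>ks\<close> holds the points already passed, and
  \<open>odd_points ks\<close> is the matching state of \<open>forget_points\<close>. A further
  point only joins \<open>ks\<close>; a pair jumps to its left and gets its label by
  \<open>points_DA\<close>.\<close>

lemma move_points_right:
  assumes "w \<in> words (Gd_gens n)" "set ks \<subseteq> {1..n}"
  shows "(points ks @ w, add_points (forget_points (odd_points ks) w) @ points (ks @ points_of w))
    \<in> d_cong n"
  using assms
proof (induction w arbitrary: ks rule: points_of.induct)
  case 1
  then show ?case by (auto intro: word_cong.refl)
next
  case (2 p b w)
  then obtain i j where p: "p = {i, j}" and ij: "i \<in> {1..n}" "j \<in> {1..n}" "i < j"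
    by (auto elim: Gd_gensE)
  let ?c = "point_conj p (label (odd_points ks) p)"
  have c: "?c \<in> words (Gd_gens n)"
    using p ij by auto
  have "(points ks @ (DA p, b) # w, points ks @ (DA p, False) # w) \<in> d_cong n" (is "(_, ?x) \<in> _")
    by (rule word_cong_step[OF d_letter_cong_positive[of "DA p"], where a = "points ks" and b = w])
      (use 2 in auto)
  also have "(?x, ?c @ points ks @ w) \<in> d_cong n" (is "(_, ?x) \<in> _")
    unfolding p
    by (rule word_cong_step[OF points_DA[OF ij 2(3)], where a = "[]" and b = w])
      (use 2 p in auto)
  also have "(?x, ?c @ add_points (forget_points (odd_points ks) w) @ points (ks @ points_of w))
      \<in> d_cong n"
    by (rule word_cong.append[OF word_cong.refl[OF c] "2.IH"]) (use 2 in auto)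
  finally show ?case by simp
next
  case (3 k b w)
  have state: "odd_points (ks @ [k]) = (odd_points ks)(k := \<not> odd_points ks k)"
    by auto
  have "(points ks @ (Tau k, b) # w, points (ks @ [k]) @ w) \<in> d_cong n" (is "(_, ?x) \<in> _")
    by (rule word_cong_step[OF d_letter_cong_positive[of "Tau k"], where a = "points ks" and b = w])
      (use 3 in auto)
  also have "(?x, add_points (forget_points (odd_points (ks @ [k])) w)
      @ points ((ks @ [k]) @ points_of w)) \<in> d_cong n"
    by (rule "3.IH") (use 3 in auto)
  finally show ?case
    by (simp only: state forget_points.simps points_of.simps append_assoc append_Cons append_Nil)
qed

text \<open>
  Conjugation by points transports relations: the labelled relations hold because they
  are obtained from the unlabelled ones by moving suitable points through both sides.
\<close>

lemma add_forget_points_cong: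
  assumes uv: "(u, v) \<in> d_cong n" and "points_of u = []" "points_of v = []"
    and "set ks \<subseteq> {1..n}"
  shows "(add_points (forget_points (odd_points ks) u),
    add_points (forget_points (odd_points ks) v)) \<in> d_cong n"
proof (rule points_cancel_right)
  have w: "u \<in> words (Gd_gens n)" "v \<in> words (Gd_gens n)"
    using word_cong_words[OF uv] by auto
  have "(add_points (forget_points (odd_points ks) u) @ points ks, points ks @ u) \<in> d_cong n" (is "(_, ?x) \<in> _")
    using word_cong.sym[OF move_points_right[OF w(1) assms(4)]] assms(2) by simp
  also have "(?x, points ks @ v) \<in> d_cong n" (is "(_, ?x) \<in> _")
    by (rule word_cong_step[OF uv, where a = "points ks" and b = "[]"]) (use w assms in auto)
  also have "(?x, add_points (forget_points (odd_points ks) v) @ points ks) \<in> d_cong n"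
    using move_points_right[OF w(2) assms(4)] assms(3) by simp
  finally show "(add_points (forget_points (odd_points ks) u) @ points ks,
    add_points (forget_points (odd_points ks) v) @ points ks) \<in> d_cong n" .
qed

section \<open>Labelled relations in the group with points\<close>

lemma add_points_square:
  assumes "i \<in> {1..n}" "j \<in> {1..n}" "i \<noteq> j" "\<epsilon> \<in> {0, 1}"
  shows "(add_points (pa i j \<epsilon> @ pa i j \<epsilon>), []) \<in> d_cong n"
  \<comment> \<open>Marking i alone gives the pair label 1, marking nothing gives label 0.\<close>
  using add_forget_points_cong[OF d_square[OF assms(1-3)], of "if \<epsilon> = 0 then [] else [i]"] assms
  by (auto simp: label_pair simp del: add_points.simps(2))

lemma add_points_commute:
  assumes "{i, j, k, l} \<subseteq> {1..n}" "distinct [i, j, k, l]" "{\<epsilon>, \<epsilon>'} \<subseteq> {0, 1}"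
  shows "(add_points (pa i j \<epsilon> @ pa k l \<epsilon>'), add_points (pa k l \<epsilon>' @ pa i j \<epsilon>)) \<in> d_cong n"
  \<comment> \<open>The pairs are disjoint, so marks on i and k set the two labels
    independently.\<close>
  using add_forget_points_cong[OF d_commute[OF assms(1,2)],
      of "(if \<epsilon> = 0 then [] else [i]) @ (if \<epsilon>' = 0 then [] else [k])"] assms
  by (auto simp: label_pair simp del: add_points.simps(2))

text \<open>Three labels with even sum are all 0, or exactly two of them are 1; in the second case
  marking the common endpoint of those two pairs produces them.\<close>

lemma add_points_triangle:
  assumes "{i, j, k} \<subseteq> {1..n}" "distinct [i, j, k]" "{\<epsilon>, \<epsilon>', \<epsilon>''} \<subseteq> {0, 1}"
    "even (\<epsilon> + \<epsilon>' + \<epsilon>'')"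
  shows "(add_points (pa i j \<epsilon> @ pa i k \<epsilon>' @ pa j k \<epsilon>''),
    add_points (pa j k \<epsilon>'' @ pa i k \<epsilon>' @ pa i j \<epsilon>)) \<in> d_cong n"
  using add_forget_points_cong[OF d_triangle[OF assms(1,2)],
      of "if \<epsilon> = 0 then if \<epsilon>' = 0 then [] else [k] else if \<epsilon>' = 0 then [j] else [i]"] assms
  by (auto simp: label_pair simp del: add_points.simps(2))

lemma add_points_cong:
  assumes "(u, v) \<in> p_cong n"
  shows "(add_points u, add_points v) \<in> d_cong n"
  using assms
proof (induction rule: word_cong.induct)
  case (append u u' v v')
  then show ?case by (simp add: add_points_append word_cong.append)
next
  case (cancel x b)
  then obtain i j \<epsilon> where "x = PA {i, j} \<epsilon>" "i \<in> {1..n}" "j \<in> {1..n}" "i < j" "\<epsilon> \<in> {0, 1}"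
    by (rule Gp_gensE)
  \<comment> \<open>\<open>add_points\<close> ignores inverse marks, so a formal cancellation
    becomes the square of a labelled generator.\<close>
  then show ?case using add_points_square[of i n j \<epsilon>] by auto
next
  case (relation u v)
  from relation(1) show ?case
    unfolding Gp_rels_def
  proof (elim UnE CollectE exE conjE, goal_cases)
    case (1 i j \<epsilon>)
    then show ?case using add_points_square[of i n j \<epsilon>] by simp
  next
    case (2 i j k l \<epsilon> \<epsilon>')
    then show ?case using add_points_commute[of i j k l n \<epsilon> \<epsilon>'] by simp
  next
    case (3 i j k \<epsilon> \<epsilon>' \<epsilon>'')
    then show ?case using add_points_triangle[of i j k n \<epsilon> \<epsilon>' \<epsilon>''] by simp
  qed
qed (auto intro: word_cong.intros add_points_words)

section \<open>Injectivity and image\<close>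

lemma add_points_cong_iff:
  assumes "u \<in> words (Gp_gens n)" "v \<in> words (Gp_gens n)"
  shows "(add_points u, add_points v) \<in> d_cong n \<longleftrightarrow> (u, v) \<in> p_cong n"
proof
  assume "(add_points u, add_points v) \<in> d_cong n"
  \<comment> \<open>Started in the empty state, \<open>forget_points\<close> undoes
    \<open>add_points\<close> up to inverse marks and so carries the congruence back.\<close>
  then have "(positive u, positive v) \<in> p_cong n"
    using forget_points_cong[of "add_points u" "add_points v" n "\<lambda>_. False"]
    by (simp add: forget_add_points[OF assms(1)] forget_add_points[OF assms(2)])
  then show "(u, v) \<in> p_cong n"
    using assms by (meson p_cong_positive word_cong.sym word_cong.trans)
qed (rule add_points_cong)

text \<open>A letter labelled 1 contributes the same point twice, a letter labelled 0 contributes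
  none.\<close>

lemma even_tau_count_add_points:
  "w \<in> words (Gp_gens n) \<Longrightarrow> even (tau_count i (add_points w))"
  by (induction w rule: add_points.induct) auto

lemma H2d_eq_image:
  "H2d n = (\<lambda>w. word_class (Gd_gens n) (Gd_rels n) (add_points w)) ` words (Gp_gens n)"
  (is "_ = ?I")
proof (intro equalityI subsetI)
  fix X assume X: "X \<in> H2d n"
  then have "X \<in> carrier (presented_group (Gd_gens n) (Gd_rels n))"
    by (simp add: H2d_def G2d_def)
  then obtain w where w: "w \<in> words (Gd_gens n)" "X = word_class (Gd_gens n) (Gd_rels n) w"
    by (rule carrier_presented_groupE)
  let ?v = "forget_points (\<lambda>_. False) w"
  have v: "?v \<in> words (Gp_gens n)"
    using w by (simp add: forget_points_words)
  have s: "set (points_of w) \<subseteq> {1..n}"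
    by (rule points_of_words[OF w(1)])
  \<comment> \<open>Membership in \<open>H2d\<close> speaks only of indices in {1..n}, whereas
    \<open>points_even\<close> asks for all of them; outside this range no point occurs and the
    count is 0.\<close>
  have "even (count_list (points_of w) i)" for i
  proof (cases "i \<in> {1..n}")
    case True
    then show ?thesis using X w by (simp add: word_class_in_H2d_iff count_points_of)
  next
    case False
    then have "i \<notin> set (points_of w)"
      using s by blast
    then show ?thesis by simp
  qed
  with s have e: "(points (points_of w), []) \<in> d_cong n"
    by (rule points_even)
  have "(w, add_points ?v @ points (points_of w)) \<in> d_cong n" (is "(_, ?x) \<in> _")
    using move_points_right[OF w(1), of "[]"] by simp
  also have "(?x, add_points ?v) \<in> d_cong n"
    by (rule word_cong_step[OF e, where a = "add_points ?v" and b = "[]"])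
      (use v s in \<open>auto simp: add_points_words\<close>)
  finally have "X = word_class (Gd_gens n) (Gd_rels n) (add_points ?v)"
    using w v by (simp add: word_class_eq_iff add_points_words)
  with v show "X \<in> ?I" by blast
next
  fix X assume "X \<in> ?I"
  then show "X \<in> H2d n"
    by (auto simp: word_class_in_H2d_iff add_points_words even_tau_count_add_points)
qed

theorem theorem3p7:
  fixes n :: nat
  assumes "n \<ge> 1"
  shows "G2p n \<cong> (G2d n)\<lparr>carrier := H2d n\<rparr>"
  unfolding G2p_def G2d_def
  \<comment> \<open>\<open>add_points_cong_iff\<close> gives both well-definedness and injectivity,
    \<open>H2d_eq_image\<close> identifies the image.\<close>
  by (rule presented_group_iso[where h = add_points])
    (simp_all only: add_points_words add_points_append add_points_cong_iff H2d_eq_image)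

end
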